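(* Let $n \in \mathbb{N}$ and suppose that the equation $\varphi(x) = n$ has a unique solution $x = x_0$ among the positive integers. Then $x_0$ is a multiple of $2^2 \cdot 3^2 \cdot 7^2 \cdot 43^2$.
   Context: $\varphi$ denotes Euler's totient function and $\mathbb{N} = \{0, 1, 2, \dots\}$. *)

theory Defs
  imports "HOL-Number_Theory.Totient"
begin

end

(*
  If p is prime, p does not divide k and p - 1 divides k, then
  phi(p k) = (p - 1) phi(k) = phi((p - 1) k), so neither p k nor (p - 1) k can be the unique
  solution. Hence a unique solution divisible by (p - 1)^2 is divisible by p^2. Apply this
  successively to p = 2, 3 = 2 + 1, 7 = 2 * 3 + 1 and 43 = 2 * 3 * 7 + 1.
*)
theory Submission
  imports Defs
begin

text \<open>In phi(d n) phi(gcd(d, n)) = phi(d) phi(n) gcd(d, n) the gcd is d, and phi(d) > 0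
  cancels unless d = 0.\<close>

lemma totient_mult_dvd:
  assumes "d dvd n"
  shows "totient (d * n) = d * totient n"
proof (cases "d = 0")
  case False
  have "totient (d * n) * totient d = (d * totient n) * totient d"
    using totient_gcd[of d n] assms by (simp add: gcd_proj1_if_dvd mult_ac)
  with False show ?thesis by simp
qed simp

lemma totient_prime_mult_eq:
  assumes "prime p" "\<not> p dvd k" "p - 1 dvd k"
  shows "totient (p * k) = totient ((p - 1) * k)"
proof -
  have "coprime p k" using assms by (simp add: prime_imp_coprime)
  then show ?thesis
    using assms by (simp add: totient_mult_coprime totient_prime totient_mult_dvd)
qed

text \<open>The exclusion \<open>neq\<close> is used twice, each time yielding one factor p: first
  for the cofactor of p - 1 in x, then for the cofactor of p.\<close>

lemma unique_totient_prime_square_dvd: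
  fixes x p :: nat
  assumes unique: "\<And>y. y > 0 \<Longrightarrow> totient y = totient x \<Longrightarrow> y = x"
    and "x > 0" "prime p" and dvd: "(p - 1)^2 dvd x"
  shows "p^2 dvd x"
proof -
  have p: "p > 1" using \<open>prime p\<close> by (rule prime_gt_1_nat)
  have neq: "x \<noteq> p * k \<and> x \<noteq> (p - 1) * k" if "\<not> p dvd k" "p - 1 dvd k" for k
  proof -
    \<comment> \<open>Since p divides 0, k is nonzero; hence the two products are distinct and
      positive.\<close>
    have "k > 0" using that by (auto intro: Nat.gr0I)
    then have "p * k \<noteq> (p - 1) * k" "p * k > 0" "(p - 1) * k > 0" using p by auto
    with unique totient_prime_mult_eq[OF \<open>prime p\<close> that] show ?thesis by metis
  qed
  have cop: "coprime (p - 1) p"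
    using p by (intro coprime_diff_one_left_nat) simp
  \<comment> \<open>The square in \<open>dvd\<close> leaves a second factor p - 1 in m, as
    \<open>neq\<close> requires.\<close>
  obtain m where m: "x = (p - 1) * m" "p - 1 dvd m"
    using dvd p by (auto simp: power2_eq_square elim!: dvdE)
  have "p dvd m" using neq[of m] m by blast
  then obtain k where k: "x = p * k" using m(1) by (metis dvd_def dvd_mult)
  have "p - 1 dvd p * k" using m k by (metis dvd_triv_left)
  then have "p - 1 dvd k" using cop by (simp add: coprime_dvd_mult_right_iff)
  then have "p dvd k" using neq[of k] k by blast
  with k show ?thesis by (simp add: power2_eq_square)
qed

theorem lemma3:
  fixes n x\<^sub>0 :: nat
  assumes "\<exists>!x::nat. x > 0 \<and> totient x = n"
    and "x\<^sub>0 > 0" and "totient x\<^sub>0 = n"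
  shows "2^2 * 3^2 * 7^2 * 43^2 dvd x\<^sub>0"
proof -
  have unique: "y = x\<^sub>0" if "y > 0" "totient y = totient x\<^sub>0" for y
    using assms that by metis
  note step = unique_totient_prime_square_dvd[OF unique \<open>x\<^sub>0 > 0\<close>]
  \<comment> \<open>For p = 2 the divisor (p - 1)^2 is 1, so the chain starts
    unconditionally.\<close>
  have 2: "2^2 dvd x\<^sub>0" by (rule step) auto
  have 3: "3^2 dvd x\<^sub>0" by (rule step) (use 2 in auto)
  have "coprime (2^2) (3^2 :: nat)" by (simp add: coprime_iff_gcd_eq_1 gcd_non_0_nat)
  from divides_mult[OF 2 3 this] have 6: "2^2 * 3^2 dvd x\<^sub>0" .
  have 7: "7^2 dvd x\<^sub>0" by (rule step) (use 6 in auto)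
  have "coprime (2^2 * 3^2) (7^2 :: nat)" by (simp add: coprime_iff_gcd_eq_1 gcd_non_0_nat)
  from divides_mult[OF 6 7 this] have 42: "2^2 * 3^2 * 7^2 dvd x\<^sub>0" .
  \<comment> \<open>The chain ends with 43, as 2 * 3 * 7 * 43 + 1 = 1807 = 13 * 139 is not
    prime.\<close>
  have 43: "43^2 dvd x\<^sub>0" by (rule step) (use 42 in auto)
  have "coprime (2^2 * 3^2 * 7^2) (43^2 :: nat)" by (simp add: coprime_iff_gcd_eq_1 gcd_non_0_nat)
  from divides_mult[OF 42 43 this] show ?thesis .
qed

end
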